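(* The map $\mathcal E : 2^\omega \to 2^\omega$ is a uniform coarsening.
   Context: For $A \subseteq \omega$ and $n \geq 1$ let $\rho_n(A) = |A \cap [0,n)|/n$; the density $\rho(A)$ is $\lim_n \rho_n(A)$ when it exists. $D$ is a coarse description of $X$ if $\rho(D \triangle X) = 0$. Let $I_n = [n!,(n+1)!)$, $\mathcal I(A) = \bigcup_{n \in A} I_n$, $\mathcal H(A) = \{\langle n,i\rangle : n \in A,\ i \in \omega\}$ (with $\langle\cdot,\cdot\rangle$ a computable pairing function), and $\mathcal E(A) = \mathcal I(\mathcal H(A))$. A map $\mathcal C : 2^\omega \to 2^\omega$ is a coarsening if for each $A$ we have $\mathcal C(A) \leq_{\mathrm T} A$, and for each coarse description $D$ of $\mathcal C(A)$ we have $A \leq_{\mathrm T} D$. A coarsening $\mathcal C$ is uniform if there is a binary Turing functional $\Gamma$ such that for every $A$ and every coarse description $D$ of $\mathcal C(A)$: (i) $\Gamma^D$ is total; and (ii) letting $A_s(n) = \Gamma^D(n,s)$, we have $A_s = A$ for cofinitely many $s$. *)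

theory Defs
  imports Complex_Main "HOL-Library.Nat_Bijection"
begin

section \<open>Turing functionals\<close>

text \<open>
  Programs for Kleene's partial recursive functions relative to an oracle. A program is a finite
  object that does not mention the oracle, so it denotes a Turing functional: the oracle
  \<open>X\<close> is supplied only on evaluation. \<open>eval X p xs = None\<close> means that the computation of \<open>p\<close>
  with oracle \<open>X\<close> on the arguments \<open>xs\<close> diverges (or has the wrong number of arguments).
\<close>

datatype prog =
    Zero
  | Succ
  | Query
  | Proj nat
  | Comp prog "prog list"
  | PrimRec prog prog
  | Mu prog

fun eval :: "nat set \<Rightarrow> prog \<Rightarrow> nat list \<Rightarrow> nat option" where
  "eval X Zero xs = Some 0"
| "eval X Succ xs = (case xs of [x] \<Rightarrow> Some (Suc x) | _ \<Rightarrow> None)"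
| "eval X Query xs = (case xs of [x] \<Rightarrow> Some (of_bool (x \<in> X)) | _ \<Rightarrow> None)"
| "eval X (Proj i) xs = (if i < length xs then Some (xs ! i) else None)"
| "eval X (Comp p qs) xs = Option.bind (those (map (\<lambda>q. eval X q xs) qs)) (eval X p)"
| "eval X (PrimRec p q) xs =
    (case xs of
       [] \<Rightarrow> None
     | n # ys \<Rightarrow> rec_nat (eval X p ys) (\<lambda>k r. Option.bind r (\<lambda>v. eval X q (k # v # ys))) n)"
| "eval X (Mu p) xs =
    (if \<exists>n. eval X p (n # xs) = Some 0 \<and> (\<forall>m<n. \<exists>v>0. eval X p (m # xs) = Some v)
     then Some (LEAST n. eval X p (n # xs) = Some 0) else None)"

definition turing_reducible :: "nat set \<Rightarrow> nat set \<Rightarrow> bool" (infix "\<le>\<^sub>T" 50) where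
  "A \<le>\<^sub>T B \<longleftrightarrow> (\<exists>p. \<forall>n. eval B p [n] = Some (of_bool (n \<in> A)))"

definition computable_pairing :: "(nat \<times> nat \<Rightarrow> nat) \<Rightarrow> bool" where
  "computable_pairing pr \<longleftrightarrow>
     bij pr \<and> (\<exists>p. \<forall>n i. eval {} p [n, i] = Some (pr (n, i)))"

lemma computable_pairing_prod_encode: "computable_pairing prod_encode"
proof -
  define add where "add = PrimRec (Proj 0) (Comp Succ [Proj 1])"
  define tri where "tri = PrimRec Zero (Comp add [Proj 1, Comp Succ [Proj 0]])"
  have add: "eval {} add [x, y] = Some (x + y)" for x y
    by (induction x) (simp_all add: add_def)
  have tri: "eval {} tri [x] = Some (triangle x)" for x
    by (induction x) (simp_all add: tri_def add)
  have "eval {} (Comp add [Comp tri [add], Proj 0]) [n, i] = Some (prod_encode (n, i))" for n i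
    by (simp add: add tri prod_encode_def)
  then show ?thesis
    unfolding computable_pairing_def using bij_prod_encode by blast
qed


section \<open>Density and coarse descriptions\<close>

text \<open>At \<open>n = 0\<close> the quotient has the junk value \<open>0\<close>, which does not affect limits.\<close>

definition partial_density :: "nat \<Rightarrow> nat set \<Rightarrow> real" where
  "partial_density n A = real (card (A \<inter> {0..<n})) / real n"

definition has_density :: "nat set \<Rightarrow> real \<Rightarrow> bool" where
  "has_density A d \<longleftrightarrow> (\<lambda>n. partial_density n A) \<longlonglongrightarrow> d"

definition coarse_description :: "nat set \<Rightarrow> nat set \<Rightarrow> bool" where
  "coarse_description D X \<longleftrightarrow> has_density (sym_diff D X) 0"


section \<open>Coarsenings\<close>

definition coarsening :: "(nat set \<Rightarrow> nat set) \<Rightarrow> bool" where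
  "coarsening C \<longleftrightarrow>
     (\<forall>A. C A \<le>\<^sub>T A \<and> (\<forall>D. coarse_description D (C A) \<longrightarrow> A \<le>\<^sub>T D))"

text \<open>
  The values of a Turing functional are arbitrary numbers, so \<open>A\<^sub>s = A\<close> is read as equality of
  \<open>A\<^sub>s\<close> with the characteristic function of \<open>A\<close>.
\<close>

definition uniform_coarsening :: "(nat set \<Rightarrow> nat set) \<Rightarrow> bool" where
  "uniform_coarsening C \<longleftrightarrow> coarsening C \<and>
     (\<exists>\<Gamma>. \<forall>A D. coarse_description D (C A) \<longrightarrow>
        (\<forall>n s. eval D \<Gamma> [n, s] \<noteq> None) \<and>
        (\<forall>\<^sub>F s in cofinite. (\<lambda>n. eval D \<Gamma> [n, s]) = (\<lambda>n. Some (of_bool (n \<in> A)))))"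


section \<open>The map \<open>\<E>\<close>\<close>

definition block :: "nat \<Rightarrow> nat set" where
  "block n = {fact n..<fact (n + 1)}"

definition block_code :: "nat set \<Rightarrow> nat set" where
  "block_code A = (\<Union>n\<in>A. block n)"

definition column_code :: "(nat \<times> nat \<Rightarrow> nat) \<Rightarrow> nat set \<Rightarrow> nat set" where
  "column_code pr A = {pr (n, i) | n i. n \<in> A}"

definition coarse_code :: "(nat \<times> nat \<Rightarrow> nat) \<Rightarrow> nat set \<Rightarrow> nat set" where
  "coarse_code pr A = block_code (column_code pr A)"

end

theory Submission
  imports Defs
begin

text \<open>
  A coarse description \<open>D\<close> of \<open>\<I>(B)\<close> can disagree with \<open>\<I>(B)\<close> on at least half of the block
  \<open>I\<^sub>k\<close> for finitely many \<open>k\<close> only, because \<open>I\<^sub>k\<close> makes up at least half of \<open>[0, (k+1)!)\<close>. So the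
  majority vote of \<open>D\<close> on \<open>I\<^sub>k\<close> decides \<open>k \<in> B\<close> for almost all \<open>k\<close>. With \<open>B = \<H>(A)\<close>, let
  \<open>\<Gamma>\<^sup>D(n, s)\<close> be the majority vote of \<open>D\<close> on the block with index \<open>\<langle>n, s\<rangle>\<close>. Each of the finitely
  many wrong votes affects a single column \<open>s\<close>, hence \<open>A\<^sub>s = A\<close> for almost all \<open>s\<close>.
\<close>

section \<open>Total Turing functionals\<close>

text \<open>The program is chosen before the oracle, which is the uniformity that
  \<open>\<Gamma>\<close> has to have. Totality at a fixed arity makes divergence irrelevant, so the
  closure properties below speak of ordinary functions.\<close>

definition total_functional :: "nat \<Rightarrow> (nat set \<Rightarrow> nat list \<Rightarrow> nat) \<Rightarrow> bool" where
  "total_functional k F \<longleftrightarrow> (\<exists>p. \<forall>X xs. length xs = k \<longrightarrow> eval X p xs = Some (F X xs))"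

section \<open>Composition, primitive recursion and minimization\<close>

lemma total_functional_cong:
  assumes "\<And>X xs. length xs = k \<Longrightarrow> F X xs = G X xs"
  shows "total_functional k F \<longleftrightarrow> total_functional k G"
  using assms by (simp add: total_functional_def)

lemma those_map_Some: "those (map (\<lambda>x. Some (f x)) xs) = Some (map f xs)"
  by (induction xs) simp_all

lemma total_functional_comp:
  assumes H: "total_functional (length Gs) H"
    and Gs: "\<And>G. G \<in> set Gs \<Longrightarrow> total_functional k G"
  shows "total_functional k (\<lambda>X xs. H X (map (\<lambda>G. G X xs) Gs))"
proof -
  obtain p where p: "\<And>X ys. length ys = length Gs \<Longrightarrow> eval X p ys = Some (H X ys)"
    using H by (auto simp: total_functional_def)
  have "\<forall>G\<in>set Gs. \<exists>q. \<forall>X xs. length xs = k \<longrightarrow> eval X q xs = Some (G X xs)"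
    using Gs by (auto simp: total_functional_def)
  then obtain Q where Q: "\<And>G X xs. G \<in> set Gs \<Longrightarrow> length xs = k \<Longrightarrow> eval X (Q G) xs = Some (G X xs)"
    by metis
  have "eval X (Comp p (map Q Gs)) xs = Some (H X (map (\<lambda>G. G X xs) Gs))" if "length xs = k" for X xs
  proof -
    have "map (\<lambda>q. eval X q xs) (map Q Gs) = map (\<lambda>G. Some (G X xs)) Gs"
      using Q that by simp
    then show ?thesis
      using p by (simp add: those_map_Some del: map_map)
  qed
  then show ?thesis
    unfolding total_functional_def by blast
qed

lemma total_functional_nth: "i < k \<Longrightarrow> total_functional k (\<lambda>X xs. xs ! i)"
  unfolding total_functional_def by (rule exI[of _ "Proj i"]) simp

lemma total_functional_const: "total_functional k (\<lambda>X xs. c)"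
proof (induction c)
  case 0
  show ?case
    unfolding total_functional_def by (rule exI[of _ Zero]) simp
next
  case (Suc c)
  have "total_functional (length [\<lambda>(X::nat set) (xs::nat list). c]) (\<lambda>X ys. Suc (ys ! 0))"
    unfolding total_functional_def by (rule exI[of _ Succ]) (auto simp: length_Suc_conv)
  from total_functional_comp[OF this, of k] Suc show ?case
    by simp
qed

text \<open>Composition with projections: arguments may be permuted, repeated or omitted.\<close>

lemma total_functional_reindex:
  assumes "total_functional k F" "length js = k" "\<And>j. j \<in> set js \<Longrightarrow> j < m"
  shows "total_functional m (\<lambda>X xs. F X (map ((!) xs) js))"
proof -
  have "total_functional m (\<lambda>X xs. F X (map (\<lambda>G. G X xs) (map (\<lambda>j X xs. xs ! j) js)))"
    using assms by (intro total_functional_comp) (auto intro: total_functional_nth)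
  then show ?thesis
    by (simp add: o_def)
qed

lemma drop_conv_map_nth: "drop j xs = map ((!) xs) [j..<length xs]"
  by (simp add: list_eq_iff_nth_eq)

text \<open>Recursions and sums put counters and intermediate values in front of the parameters.
  This lets a functional of the parameters be used there.\<close>

lemma total_functional_drop:
  assumes "total_functional k F"
  shows "total_functional (j + k) (\<lambda>X xs. F X (drop j xs))"
proof -
  have "total_functional (j + k) (\<lambda>X xs. F X (map ((!) xs) [j..<j + k]))"
    using assms by (rule total_functional_reindex) auto
  then show ?thesis
    by (subst total_functional_cong[where G = "\<lambda>X xs. F X (map ((!) xs) [j..<j + k])"])
      (simp_all add: drop_conv_map_nth)
qed

lemma total_functional_comp1:
  assumes "total_functional 1 (\<lambda>X ys. h X (ys ! 0))" "total_functional k f"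
  shows "total_functional k (\<lambda>X xs. h X (f X xs))"
  using total_functional_comp[of "[f]" "\<lambda>X ys. h X (ys ! 0)" k] assms by simp

lemma total_functional_comp2:
  assumes "total_functional 2 (\<lambda>X ys. h X (ys ! 0) (ys ! 1))"
    "total_functional k f" "total_functional k g"
  shows "total_functional k (\<lambda>X xs. h X (f X xs) (g X xs))"
  using total_functional_comp[of "[f, g]" "\<lambda>X ys. h X (ys ! 0) (ys ! 1)" k] assms
  by (auto simp: numeral_2_eq_2)

lemma total_functional_Suc:
  assumes "total_functional k f"
  shows "total_functional k (\<lambda>X xs. Suc (f X xs))"
proof (rule total_functional_comp1[where h = "\<lambda>X. Suc", OF _ assms])
  show "total_functional 1 (\<lambda>X ys. Suc (ys ! 0))"
    unfolding total_functional_def by (rule exI[of _ Succ]) (auto simp: length_Suc_conv)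
qed

lemma total_functional_query:
  assumes "total_functional k f"
  shows "total_functional k (\<lambda>X xs. of_bool (f X xs \<in> X))"
proof (rule total_functional_comp1[where h = "\<lambda>X x. of_bool (x \<in> X)", OF _ assms])
  show "total_functional 1 (\<lambda>X ys. of_bool (ys ! 0 \<in> X))"
    unfolding total_functional_def by (rule exI[of _ Query]) (auto simp: length_Suc_conv)
qed

text \<open>In \<open>g\<close> the first two arguments are the counter and the previous value. The
  recursion depth may be any computed quantity \<open>n\<close>, although \<open>PrimRec\<close>
  recurses on its first argument only.\<close>

lemma total_functional_rec:
  assumes f: "total_functional k f"
    and g: "total_functional (2 + k) (\<lambda>X ys. g X (ys ! 0) (ys ! 1) (drop 2 ys))"
    and n: "total_functional k n"
  shows "total_functional k (\<lambda>X xs. rec_nat (f X xs) (\<lambda>m v. g X m v xs) (n X xs))"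
proof -
  obtain p where p: "\<And>X xs. length xs = k \<Longrightarrow> eval X p xs = Some (f X xs)"
    using f by (auto simp: total_functional_def)
  obtain q where q: "\<And>X ys. length ys = 2 + k \<Longrightarrow> eval X q ys = Some (g X (ys ! 0) (ys ! 1) (drop 2 ys))"
    using g by (auto simp: total_functional_def)
  let ?R = "\<lambda>X ys. rec_nat (f X (tl ys)) (\<lambda>m v. g X m v (tl ys)) (hd ys)"
  have "eval X (PrimRec p q) (m # xs) = Some (?R X (m # xs))" if "length xs = k" for X m xs
    by (induction m) (use p q that in simp_all)
  then have "total_functional (Suc k) ?R"
    unfolding total_functional_def
    by (intro exI[of _ "PrimRec p q"]) (auto simp: length_Suc_conv simp del: eval.simps)
  \<comment> \<open>The computed depth becomes the head of the argument list, and projections copy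
    all parameters behind it.\<close>
  then have "total_functional k
      (\<lambda>X xs. ?R X (map (\<lambda>G. G X xs) (n # map (\<lambda>j X xs. xs ! j) [0..<k])))"
    using n by (intro total_functional_comp) (auto intro: total_functional_nth)
  then show ?thesis
    by (subst total_functional_cong[where G = "\<lambda>X xs. ?R X (map (\<lambda>G. G X xs) (n # map (\<lambda>j X xs. xs ! j) [0..<k]))"])
      (auto simp: o_def map_nth)
qed

text \<open>\<open>Mu\<close> needs a zero and defined positive values before the first one.
  Existence is assumed; the rest follows from totality of \<open>f\<close>.\<close>

lemma total_functional_Least:
  assumes f: "total_functional (Suc k) (\<lambda>X ys. f X (ys ! 0) (tl ys))"
    and ex: "\<And>X xs. length xs = k \<Longrightarrow> \<exists>n. f X n xs = 0"
  shows "total_functional k (\<lambda>X xs. LEAST n. f X n xs = 0)"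
proof -
  obtain p where p: "\<And>X ys. length ys = Suc k \<Longrightarrow> eval X p ys = Some (f X (ys ! 0) (tl ys))"
    using f by (auto simp: total_functional_def)
  have "eval X (Mu p) xs = Some (LEAST n. f X n xs = 0)" if len: "length xs = k" for X xs
  proof -
    have "f X (LEAST n. f X n xs = 0) xs = 0"
      using ex[OF len] by (rule LeastI_ex)
    moreover have "\<forall>m < (LEAST n. f X n xs = 0). f X m xs > 0"
      using not_less_Least by blast
    ultimately show ?thesis
      using p len by auto
  qed
  then show ?thesis
    unfolding total_functional_def by blast
qed

section \<open>Arithmetic and bounded sums\<close>

lemma total_functional_add:
  assumes "total_functional k f" "total_functional k g"
  shows "total_functional k (\<lambda>X xs. f X xs + g X xs)"
proof -
  have "total_functional k (\<lambda>X xs. rec_nat (g X xs) (\<lambda>m v. Suc v) (f X xs))"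
    by (intro total_functional_rec assms total_functional_Suc total_functional_nth) simp
  moreover have "rec_nat b (\<lambda>m v. Suc v) a = a + b" for a b
    by (induction a) simp_all
  ultimately show ?thesis
    by simp
qed

lemma total_functional_mult:
  assumes "total_functional k f" "total_functional k g"
  shows "total_functional k (\<lambda>X xs. f X xs * g X xs)"
proof -
  have "total_functional k (\<lambda>X xs. rec_nat 0 (\<lambda>m v. g X xs + v) (f X xs))"
    by (intro total_functional_rec assms total_functional_add total_functional_drop
        total_functional_nth total_functional_const) simp
  moreover have "rec_nat 0 (\<lambda>m v. b + v) a = a * b" for a b :: nat
    by (induction a) simp_all
  ultimately show ?thesis
    by simp
qed

lemma total_functional_diff:
  assumes "total_functional k f" "total_functional k g"
  shows "total_functional k (\<lambda>X xs. f X xs - g X xs)"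
proof -
  \<comment> \<open>Subtraction iterates the predecessor; both are truncated at 0, as on
    \<open>nat\<close>.\<close>
  have pred: "total_functional k (\<lambda>X xs. f X xs - 1)" if "total_functional k f" for k f
  proof -
    have "total_functional k (\<lambda>X xs. rec_nat 0 (\<lambda>m v. m) (f X xs))"
      by (intro total_functional_rec that total_functional_nth total_functional_const) simp
    moreover have "rec_nat 0 (\<lambda>m v. m) a = a - 1" for a :: nat
      by (cases a) simp_all
    ultimately show ?thesis
      by simp
  qed
  have "total_functional k (\<lambda>X xs. rec_nat (f X xs) (\<lambda>m v. v - 1) (g X xs))"
    by (intro total_functional_rec assms pred total_functional_nth) simp
  moreover have "rec_nat a (\<lambda>m v. v - 1) b = a - b" for a b :: nat
    by (induction b) simp_all
  ultimately show ?thesis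
    by simp
qed

lemma total_functional_less:
  assumes "total_functional k f" "total_functional k g"
  shows "total_functional k (\<lambda>X xs. of_bool (f X xs < g X xs))"
proof -
  \<comment> \<open>With truncated subtraction, \<open>1 - (1 - d)\<close> is the sign of
    \<open>d\<close>.\<close>
  have "total_functional k (\<lambda>X xs. 1 - (1 - (g X xs - f X xs)))"
    by (intro total_functional_diff total_functional_const assms)
  moreover have "1 - (1 - (b - a)) = of_bool (a < b)" for a b :: nat
    by auto
  ultimately show ?thesis
    by simp
qed

lemma total_functional_fact:
  assumes "total_functional k f"
  shows "total_functional k (\<lambda>X xs. fact (f X xs))"
proof -
  have "total_functional k (\<lambda>X xs. rec_nat 1 (\<lambda>m v. Suc m * v) (f X xs))"
    by (intro total_functional_rec assms total_functional_mult total_functional_Suc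
        total_functional_nth total_functional_const) simp_all
  moreover have "rec_nat 1 (\<lambda>m v. Suc m * v) a = fact a" for a
    by (induction a) simp_all
  ultimately show ?thesis
    by simp
qed

lemma total_functional_sum:
  assumes f: "total_functional (Suc k) (\<lambda>X ys. f X (ys ! 0) (tl ys))"
    and n: "total_functional k n"
  shows "total_functional k (\<lambda>X xs. \<Sum>i<n X xs. f X i xs)"
proof -
  let ?g = "\<lambda>X ys. f X (ys ! 0) (drop 2 ys)"
  \<comment> \<open>Position 1 is left out: it holds the partial sum, which the summand must not
    see.\<close>
  let ?js = "0 # [2..<2 + k]"
  have "total_functional (2 + k) (\<lambda>X ys. f X (map ((!) ys) ?js ! 0) (tl (map ((!) ys) ?js)))"
    using f by (rule total_functional_reindex) auto
  also have "?this \<longleftrightarrow> total_functional (2 + k) ?g"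
    by (intro total_functional_cong) (simp add: drop_conv_map_nth)
  finally have g: "total_functional (2 + k) ?g" .
  have "total_functional k (\<lambda>X xs. rec_nat 0 (\<lambda>i v. v + f X i xs) (n X xs))"
    by (intro total_functional_rec n total_functional_add g
        total_functional_nth total_functional_const) simp
  moreover have "rec_nat 0 (\<lambda>i v. v + f X i xs) m = (\<Sum>i<m. f X i xs)" for X xs m
    by (induction m) simp_all
  ultimately show ?thesis
    by simp
qed

section \<open>Independence of the oracle\<close>

text \<open>The composition \<open>Comp Zero [Succ]\<close>, like \<open>Query\<close>, is defined on lists of length one only.\<close>

lemma eval_empty_oracle: "\<exists>q. \<forall>X. eval X q = eval {} p"
proof (induction p)
  case Query
  have "eval X (Comp Zero [Succ]) = eval {} Query" for X
    by (rule ext) (simp split: list.split)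
  then show ?case
    by blast
next
  case (Comp p qs)
  then obtain p' where p': "\<And>X. eval X p' = eval {} p"
    by blast
  obtain Q where Q: "\<And>q X. q \<in> set qs \<Longrightarrow> eval X (Q q) = eval {} q"
    using Comp by metis
  have "map (\<lambda>q. eval X q xs) (map Q qs) = map (\<lambda>q. eval {} q xs) qs" for X xs
    using Q by simp
  then have "eval X (Comp p' (map Q qs)) = eval {} (Comp p qs)" for X
    using p' by (intro ext) (simp del: map_map)
  then show ?case
    by blast
next
  case (PrimRec p q)
  then obtain p' q' where "\<And>X. eval X p' = eval {} p" "\<And>X. eval X q' = eval {} q"
    by blast
  then have "eval X (PrimRec p' q') = eval {} (PrimRec p q)" for X
    by (intro ext) (simp split: list.split)
  then show ?case
    by blast
next
  case (Mu p)
  then obtain p' where "\<And>X. eval X p' = eval {} p"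
    by blast
  then have "eval X (Mu p') = eval {} (Mu p)" for X
    by (intro ext) simp
  then show ?case
    by blast
next
  case Zero
  have "eval X Zero = eval {} Zero" for X
    by (intro ext) simp
  then show ?case
    by blast
next
  case Succ
  have "eval X Succ = eval {} Succ" for X
    by (intro ext) simp
  then show ?case
    by blast
next
  case (Proj i)
  have "eval X (Proj i) = eval {} (Proj i)" for X
    by (intro ext) simp
  then show ?case
    by blast
qed

text \<open>The pairing comes with a program for the empty oracle only;
  \<open>eval_empty_oracle\<close> replaces it by one that gives the same values under every
  oracle.\<close>

lemma total_functional_pairing:
  assumes "computable_pairing pr" "total_functional k f" "total_functional k g"
  shows "total_functional k (\<lambda>X xs. pr (f X xs, g X xs))"
proof (rule total_functional_comp2[where h = "\<lambda>X n i. pr (n, i)", OF _ assms(2,3)])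
  obtain p where "\<And>n i. eval {} p [n, i] = Some (pr (n, i))"
    using assms(1) by (auto simp: computable_pairing_def)
  then obtain q where "\<And>X n i. eval X q [n, i] = Some (pr (n, i))"
    using eval_empty_oracle by metis
  then show "total_functional 2 (\<lambda>X ys. pr (ys ! 0, ys ! 1))"
    unfolding total_functional_def
    by (intro exI[of _ q]) (auto simp: numeral_2_eq_2 length_Suc_conv)
qed


section \<open>Majority votes on blocks\<close>

lemma block_disjoint:
  assumes "x \<in> block j" "x \<in> block k"
  shows "j = k"
proof -
  have False if "a < b" "x \<in> block a" "x \<in> block b" for a b
    using that fact_mono_nat[of "a + 1" b] by (simp add: block_def)
  then show ?thesis
    using assms by (metis linorder_neqE_nat)
qed

lemma block_code_Int_block: "block_code B \<inter> block k = (if k \<in> B then block k else {})"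
  by (auto simp: block_code_def dest: block_disjoint)

lemma card_block: "card (block k) = k * fact k"
  by (simp add: block_def)

text \<open>The majority is strict: a tie, as on the empty \<open>block 0\<close>, counts as a
  no.\<close>

definition majority :: "nat set \<Rightarrow> nat set" where
  "majority D = {k. card (block k) < 2 * card (D \<inter> block k)}"

lemma eventually_majority_iff:
  assumes "coarse_description D (block_code B)"
  shows "\<forall>\<^sub>F k in sequentially. k \<in> majority D \<longleftrightarrow> k \<in> B"
proof -
  define S where "S = sym_diff D (block_code B)"
  have "(\<lambda>n. partial_density n S) \<longlonglongrightarrow> 0"
    using assms by (simp add: coarse_description_def has_density_def S_def)
  \<comment> \<open>A block that fills half of \<open>[0, (k+1)!)\<close> contains errors on less
    than half of itself once the error density there is below 1/4.\<close>
  then have "\<forall>\<^sub>F n in sequentially. partial_density n S < 1 / 4"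
    by (rule order_tendstoD) simp
  then obtain N where N: "\<And>n. n \<ge> N \<Longrightarrow> partial_density n S < 1 / 4"
    by (auto simp: eventually_sequentially)
  \<comment> \<open>The bound \<open>k \<ge> 1\<close> gives \<open>k + 1 \<le> 2 * k\<close>, hence
    the half; \<open>block 0\<close> is empty.\<close>
  have "k \<in> majority D \<longleftrightarrow> k \<in> B" if k: "k \<ge> max 1 N" for k
  proof -
    have "N \<le> fact (k + 1)"
      using k fact_ge_self[of "k + 1"] by linarith
    from N[OF this] have "real (4 * card (S \<inter> {0..<fact (k + 1)})) < real (fact (k + 1))"
      by (simp add: partial_density_def divide_less_eq del: fact_Suc of_nat_fact)
    then have S: "4 * card (S \<inter> {0..<fact (k + 1)}) < fact (k + 1)"
      by linarith
    have "card (S \<inter> block k) \<le> card (S \<inter> {0..<fact (k + 1)})"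
      by (intro card_mono) (auto simp: block_def)
    moreover have "fact (k + 1) \<le> 2 * card (block k)"
      using k by (simp add: card_block)
    ultimately have small: "2 * card (S \<inter> block k) < card (block k)"
      using S by linarith
    have fin: "finite (block k)"
      by (simp add: block_def)
    \<comment> \<open>The errors in the block are the no votes if \<open>k \<in> B\<close> and the
      yes votes otherwise; in both cases they are a minority.\<close>
    show ?thesis
    proof (cases "k \<in> B")
      case True
      then have "S \<inter> block k = block k - D \<inter> block k"
        using block_code_Int_block[of B k] by (auto simp: S_def)
      then have "card (S \<inter> block k) = card (block k) - card (D \<inter> block k)"
        using fin by (simp add: card_Diff_subset)
      then show ?thesis
        using True small by (simp add: majority_def)
    next
      case False
      then have "S \<inter> block k = D \<inter> block k"
        using block_code_Int_block[of B k] by (auto simp: S_def)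
      then show ?thesis
        using False small by (simp add: majority_def)
    qed
  qed
  then show ?thesis
    by (rule eventually_sequentiallyI)
qed

text \<open>Counting from the left end of the block turns the cardinality into a bounded sum of
  queries, to which \<open>total_functional_sum\<close> applies.\<close>

lemma card_Int_block: "card (D \<inter> block k) = (\<Sum>j<k * fact k. of_bool (fact k + j \<in> D))"
proof -
  have "(\<Sum>j<k * fact k. of_bool (fact k + j \<in> D)) = card {j. j < k * fact k \<and> fact k + j \<in> D}"
    by (simp add: sum.If_cases of_bool_def Collect_conj_eq lessThan_def)
  also have "\<dots> = card ((\<lambda>j. fact k + j) ` {j. j < k * fact k \<and> fact k + j \<in> D})"
    by (intro card_image[symmetric]) simp
  also have "(\<lambda>j. fact k + j) ` {j. j < k * fact k \<and> fact k + j \<in> D} = D \<inter> block k"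
  proof (intro equalityI subsetI)
    fix x assume "x \<in> D \<inter> block k"
    then show "x \<in> (\<lambda>j. fact k + j) ` {j. j < k * fact k \<and> fact k + j \<in> D}"
      by (intro image_eqI[of _ _ "x - fact k"]) (auto simp: block_def)
  qed (auto simp: block_def)
  finally show ?thesis
    by simp
qed

lemma total_functional_majority:
  assumes "total_functional k f"
  shows "total_functional k (\<lambda>X xs. of_bool (f X xs \<in> majority X))"
proof (rule total_functional_comp1[where h = "\<lambda>X m. of_bool (m \<in> majority X)", OF _ assms])
  have "total_functional 1 (\<lambda>X ys. of_bool (ys ! 0 * fact (ys ! 0) <
      2 * (\<Sum>j<ys ! 0 * fact (ys ! 0). of_bool (fact (ys ! 0) + j \<in> X))))"
  proof (intro total_functional_less total_functional_mult total_functional_fact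
      total_functional_sum total_functional_nth total_functional_const)
    have tl: "total_functional (Suc 1) (\<lambda>X ys. tl ys ! 0)"
      using total_functional_drop[of 1 "\<lambda>X xs. xs ! 0" 1] total_functional_nth[of 0 1]
      by (simp add: drop_Suc)
    show "total_functional (Suc 1) (\<lambda>X ys. of_bool (fact (tl ys ! 0) + ys ! 0 \<in> X))"
      by (intro total_functional_query total_functional_add total_functional_fact
          total_functional_nth tl) simp
  qed simp_all
  then show "total_functional 1 (\<lambda>X ys. of_bool (ys ! 0 \<in> majority X))"
    by (simp add: majority_def card_Int_block card_block)
qed


section \<open>Computing the code\<close>

text \<open>
  The pair \<open>(n, i)\<close> with \<open>x\<close> in the block of index \<open>pr (n, i)\<close> is found by searching through the
  squares \<open>[0, m)\<^sup>2\<close>. The search succeeds unless \<open>x = 0\<close>, the only number that lies in no block.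
\<close>

lemma ex_block:
  assumes "x > 0"
  shows "\<exists>k. x \<in> block k"
proof -
  have "x < fact (x + 1)"
    using fact_ge_self[of "x + 1"] by linarith
  then obtain k where k: "x < fact (k + 1)" "\<And>j. j < k \<Longrightarrow> \<not> x < fact (j + 1)"
    using exists_least_iff[of "\<lambda>k. x < fact (k + 1)"] by blast
  \<comment> \<open>For \<open>k > 0\<close> this is minimality of \<open>k\<close>; for
    \<open>k = 0\<close> it is \<open>x \<ge> 1 = 0!\<close>.\<close>
  then have "fact k \<le> x"
    using assms by (cases k) (auto simp: not_less)
  then show ?thesis
    using k(1) by (auto simp: block_def)
qed

lemma zero_notin_block: "0 \<notin> block k"
  by (simp add: block_def)

text \<open>A positive count stands for a bounded existential quantifier. With
  \<open>X = UNIV\<close> it tells whether the search has reached the block of \<open>x\<close>;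
  with the oracle as \<open>X\<close> it gives the answer.\<close>

definition square_hits ::
    "(nat \<times> nat \<Rightarrow> nat) \<Rightarrow> nat set \<Rightarrow> nat \<Rightarrow> nat \<Rightarrow> nat" where
  "square_hits pr X m x =
     (\<Sum>n<m. \<Sum>i<m. of_bool (x \<in> block (pr (n, i))) * of_bool (n \<in> X))"

lemma square_hits_pos_iff:
  "square_hits pr X m x > 0 \<longleftrightarrow> (\<exists>n<m. \<exists>i<m. x \<in> block (pr (n, i)) \<and> n \<in> X)"
  by (auto simp: square_hits_def sum_eq_0_iff simp flip: neq0_conv)

lemma coarse_code_iff: "x \<in> coarse_code pr A \<longleftrightarrow> (\<exists>n i. x \<in> block (pr (n, i)) \<and> n \<in> A)"
  by (auto simp: coarse_code_def block_code_def column_code_def)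

lemma ex_square_hits:
  assumes "bij pr" "x > 0"
  shows "\<exists>m. square_hits pr UNIV m x > 0"
proof -
  obtain k where "x \<in> block k"
    using ex_block assms(2) by blast
  moreover obtain n i where "k = pr (n, i)"
    using bij_is_surj[OF assms(1)] by (metis surjD surj_pair)
  ultimately have "square_hits pr UNIV (Suc (max n i)) x > 0"
    unfolding square_hits_pos_iff by (intro exI[of _ n] conjI exI[of _ i]) auto
  then show ?thesis ..
qed

text \<open>Disjoint blocks and an injective pairing leave only one candidate \<open>n\<close>, so a
  square that contains its pair settles membership. For \<open>x = 0\<close> both sides
  fail.\<close>

lemma coarse_code_iff_square_hits:
  assumes "inj pr" "x = 0 \<or> square_hits pr UNIV m x > 0"
  shows "x \<in> coarse_code pr A \<longleftrightarrow> square_hits pr A m x > 0"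
proof (cases "x = 0")
  case True
  then show ?thesis
    by (simp add: coarse_code_iff square_hits_pos_iff zero_notin_block)
next
  case False
  then obtain n i where ni: "n < m" "i < m" "x \<in> block (pr (n, i))"
    using assms(2) by (auto simp: square_hits_pos_iff)
  have unique: "n' = n" if "x \<in> block (pr (n', i'))" for n' i'
    using block_disjoint[OF that ni(3)] assms(1) by (simp add: inj_eq)
  have "x \<in> coarse_code pr A \<longleftrightarrow> n \<in> A"
    unfolding coarse_code_iff using ni(3) unique by metis
  also have "\<dots> \<longleftrightarrow> square_hits pr A m x > 0"
    unfolding square_hits_pos_iff using ni unique by metis
  finally show ?thesis .
qed

lemma total_functional_square_hits:
  assumes pr: "computable_pairing pr"
    and R: "total_functional 1 (\<lambda>X ys. of_bool (ys ! 0 \<in> R X))"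
  shows "total_functional 2 (\<lambda>X xs. square_hits pr (R X) (xs ! 0) (xs ! 1))"
  unfolding square_hits_def
proof (intro total_functional_sum total_functional_nth)
  have tl: "total_functional (Suc k) (\<lambda>X ys. F X (tl ys))" if "total_functional k F" for k F
    using total_functional_drop[OF that, of 1] by (simp add: drop_Suc)
  \<comment> \<open>A conjunction of strict comparisons: \<open>fact k \<le> x\<close> is written as
    \<open>fact k < Suc x\<close> to fit \<open>total_functional_less\<close>.\<close>
  have block: "of_bool (x \<in> block k) = (of_bool (fact k < Suc x) * of_bool (x < fact (Suc k)) :: nat)" for x k
    by (simp add: block_def)
  show "total_functional (Suc (Suc 2)) (\<lambda>X ys. of_bool (tl (tl ys) ! 1 \<in> block (pr (tl ys ! 0, ys ! 0))) *
      of_bool (tl ys ! 0 \<in> R X))"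
    unfolding block
    by (intro total_functional_mult total_functional_less total_functional_fact total_functional_Suc
        total_functional_pairing[OF pr] total_functional_comp1[OF R] total_functional_nth tl) simp_all
  show "total_functional (Suc 2) (\<lambda>X ys. tl ys ! 0)"
    by (intro tl total_functional_nth) simp
qed simp_all

lemma total_functional_coarse_code:
  assumes "computable_pairing pr"
  shows "total_functional 1 (\<lambda>X xs. of_bool (xs ! 0 \<in> coarse_code pr X))"
proof -
  have bij: "bij pr"
    using assms by (simp add: computable_pairing_def)
  have hits: "total_functional 2 (\<lambda>X xs. square_hits pr UNIV (xs ! 0) (xs ! 1))"
    using total_functional_square_hits[OF assms, of "\<lambda>X. UNIV"] total_functional_const[of 1 1]
    by simp
  have hits_oracle: "total_functional 2 (\<lambda>X xs. square_hits pr X (xs ! 0) (xs ! 1))"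
    by (intro total_functional_square_hits assms total_functional_query total_functional_nth) simp
  \<comment> \<open>A zero of \<open>?f\<close> in \<open>m\<close> signals a finished search. The
    term \<open>of_bool (0 < x)\<close> makes the search stop at once for \<open>x = 0\<close>,
    where no hit would ever occur.\<close>
  let ?f = "\<lambda>m x. of_bool (0 < x) - square_hits pr UNIV m x"
  define M where "M x = (LEAST m. ?f m x = 0)" for x
  have ex: "\<exists>m. ?f m x = 0" for x
    using ex_square_hits[OF bij, of x] by (auto simp: Suc_le_eq)
  have "total_functional 1 (\<lambda>X xs. LEAST m. ?f m (xs ! 0) = 0)"
  proof (rule total_functional_Least)
    have tl: "total_functional (Suc 1) (\<lambda>X ys. tl ys ! 0)"
      using total_functional_drop[of 1 "\<lambda>X xs. xs ! 0" 1] total_functional_nth[of 0 1]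
      by (simp add: drop_Suc)
    show "total_functional (Suc 1) (\<lambda>X ys. ?f (ys ! 0) (tl ys ! 0))"
      by (intro total_functional_diff total_functional_less total_functional_const tl
          total_functional_comp2[OF hits] total_functional_nth) simp
  qed (rule ex)
  then have M: "total_functional 1 (\<lambda>X xs. M (xs ! 0))"
    by (simp add: M_def)
  have "total_functional 1 (\<lambda>X xs. of_bool (0 < square_hits pr X (M (xs ! 0)) (xs ! 0)))"
    by (intro total_functional_less total_functional_const M
        total_functional_comp2[OF hits_oracle] total_functional_nth) simp
  moreover have "x \<in> coarse_code pr X \<longleftrightarrow> 0 < square_hits pr X (M x) x" for X x
  proof (rule coarse_code_iff_square_hits)
    have "?f (M x) x = 0"
      unfolding M_def using ex by (rule LeastI_ex)
    then show "x = 0 \<or> square_hits pr UNIV (M x) x > 0"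
      by (cases "x = 0") auto
  qed (use bij bij_is_inj in blast)
  ultimately show ?thesis
    by simp
qed

lemma coarse_code_reducible:
  assumes "computable_pairing pr"
  shows "coarse_code pr A \<le>\<^sub>T A"
proof -
  obtain p where "\<And>X xs. length xs = 1 \<Longrightarrow> eval X p xs = Some (of_bool (xs ! 0 \<in> coarse_code pr X))"
    using total_functional_coarse_code[OF assms] by (auto simp: total_functional_def)
  then have "eval A p [n] = Some (of_bool (n \<in> coarse_code pr A))" for n
    by simp
  then show ?thesis
    unfolding turing_reducible_def by blast
qed

section \<open>Columns of votes and the uniform coarsening\<close>

lemma eventually_majority_column:
  assumes pr: "bij pr" and D: "coarse_description D (coarse_code pr A)"
  shows "\<forall>\<^sub>F s in cofinite. \<forall>n. pr (n, s) \<in> majority D \<longleftrightarrow> n \<in> A"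
proof -
  have "\<forall>\<^sub>F k in cofinite. k \<in> majority D \<longleftrightarrow> k \<in> column_code pr A"
    using eventually_majority_iff[of D "column_code pr A"] D
    by (simp add: coarse_code_def cofinite_eq_sequentially)
  then have "finite {k. \<not> (k \<in> majority D \<longleftrightarrow> k \<in> column_code pr A)}" (is "finite ?W")
    by (simp add: eventually_cofinite)
  \<comment> \<open>By injectivity the wrong indices come from finitely many pairs, whose second
    components are all the columns that can be spoiled.\<close>
  then have "finite (snd ` (pr -` ?W))"
    using pr by (intro finite_imageI finite_vimageI) (auto dest: bij_is_inj)
  moreover have "pr (n, s) \<in> column_code pr A \<longleftrightarrow> n \<in> A" for n s
    using bij_is_inj[OF pr] by (auto simp: column_code_def inj_eq)
  then have "{s. \<not> (\<forall>n. pr (n, s) \<in> majority D \<longleftrightarrow> n \<in> A)} \<subseteq> snd ` (pr -` ?W)"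
    by (force simp: image_iff)
  ultimately show ?thesis
    unfolding eventually_cofinite by (rule finite_subset[rotated])
qed

theorem proposition2p3:
  fixes pr :: "nat \<times> nat \<Rightarrow> nat"
  assumes "computable_pairing pr"
  shows "uniform_coarsening (coarse_code pr)"
proof -
  have "total_functional 2 (\<lambda>X xs. of_bool (pr (xs ! 0, xs ! 1) \<in> majority X))"
    by (intro total_functional_majority total_functional_pairing assms total_functional_nth) simp_all
  \<comment> \<open>\<open>\<Gamma>\<close> is fixed before \<open>A\<close> and \<open>D\<close>,
    and it converges under every oracle.\<close>
  then obtain \<Gamma> where "\<And>X xs. length xs = 2 \<Longrightarrow>
      eval X \<Gamma> xs = Some (of_bool (pr (xs ! 0, xs ! 1) \<in> majority X))"
    by (auto simp: total_functional_def)
  then have \<Gamma>: "eval X \<Gamma> [n, s] = Some (of_bool (pr (n, s) \<in> majority X))" for X n s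
    by simp
  have ev: "\<forall>\<^sub>F s in cofinite. (\<lambda>n. eval D \<Gamma> [n, s]) = (\<lambda>n. Some (of_bool (n \<in> A)))"
    if "coarse_description D (coarse_code pr A)" for A D
    using eventually_majority_column[OF _ that] assms
    by (simp add: \<Gamma> computable_pairing_def fun_eq_iff of_bool_eq_iff)
  have "A \<le>\<^sub>T D" if D: "coarse_description D (coarse_code pr A)" for A D
  proof -
    \<comment> \<open>A reduction may depend on \<open>D\<close>: a correct column exists since
      cofinite sets of numbers are nonempty, and its index \<open>s\<close> is built into the
      program as a constant.\<close>
    obtain s where s: "(\<lambda>n. eval D \<Gamma> [n, s]) = (\<lambda>n. Some (of_bool (n \<in> A)))"
      using eventually_happens[OF ev[OF D]] by auto
    obtain c where "\<And>X xs. length xs = 1 \<Longrightarrow> eval X c xs = Some s"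
      using total_functional_const[of 1 s] by (auto simp: total_functional_def)
    then have "eval D (Comp \<Gamma> [Proj 0, c]) [n] = Some (of_bool (n \<in> A))" for n
      using fun_cong[OF s, of n] by simp
    then show ?thesis
      unfolding turing_reducible_def by blast
  qed
  then have "coarsening (coarse_code pr)"
    using coarse_code_reducible[OF assms] by (simp add: coarsening_def)
  then show ?thesis
    unfolding uniform_coarsening_def using ev \<Gamma> by (intro conjI exI[of _ \<Gamma>]) auto
qed

end
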